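(* Let $N\ge2$, let $\mathbf{X}_1,\dots,\mathbf{X}_N$ and $\mathbf{Y}_1,\dots,\mathbf{Y}_N$ be points in $\mathbb{R}^D$, and let $c(\cdot,\cdot)$ be a real-valued cost function. Assume that there exist $[\epsilon_m,\epsilon_M]\subset[0,\infty)$ and a permutation $\sigma^*:\{1,\dots,N\}\to\{1,\dots,N\}$ such that $$\kappa:=\min_{i\in\{1,\dots,N\},\,j\neq\sigma^*(i)}c(\mathbf{X}_i,\mathbf{Y}_j)>\epsilon_M\quad\text{and}\quad c(\mathbf{X}_i,\mathbf{Y}_{\sigma^*(i)})\in[\epsilon_m,\epsilon_M]\quad\text{for all }i\in\{1,\dots,N\}.$$ Let $\eta^*$ be the critical value defined in the context. Then $$\frac{4N}{\kappa'-2\epsilon_m}\le\eta^*\le\frac{2N}{\kappa-\epsilon_M},$$ where $\kappa':=\min_{i\neq j}\left[c(\mathbf{X}_i,\mathbf{Y}_{\sigma^*(j)})+c(\mathbf{X}_j,\mathbf{Y}_{\sigma^*(i)})\right]$. If the cost is symmetric around $\sigma^*$ in the sense that $c(\mathbf{X}_i,\mathbf{Y}_{\sigma^*(j)})=c(\mathbf{X}_j,\mathbf{Y}_{\sigma^*(i)})$ for all $i,j\in\{1,\dots,N\}$, then $$\frac{2N}{\kappa-\epsilon_m}\le\eta^*\le\frac{2N}{\kappa-\epsilon_M},$$ and in particular $\eta^*=\frac{2N}{\kappa}$ if $\epsilon_m=\epsilon_M=0$.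
   Context: Let $C\in\mathbb{R}^{N\times N}$ with $C_{ij}=c(\mathbf{X}_i,\mathbf{Y}_j)$. Let $\Pi_N=\{\pi\in\mathbb{R}^{N\times N}:\pi\mathbf{1}=\mathbf{1},\ \pi^\top\mathbf{1}=\mathbf{1},\ \pi_{ij}\ge0\}$ be the Birkhoff polytope of doubly stochastic matrices ($\mathbf{1}$ the all-ones vector); its set of extreme points $\exp(\Pi_N)$ is the set of permutation matrices. Let $\langle A,B\rangle=\sum_{i,j}A_{ij}B_{ij}$ be the Frobenius inner product with norm $\|\cdot\|$, $\mathcal{M}=\arg\min_{\pi\in\Pi_N}\langle C,\pi\rangle$, and $\pi^*=\arg\min_{\pi\in\mathcal{M}}\|\pi\|^2$. The critical value is $$\eta^*:=2N\cdot\max_{\pi\in\exp(\Pi_N)\setminus\mathcal{M}}\frac{\langle\pi^*,\pi^*-\pi\rangle}{\langle C,\pi-\pi^*\rangle}.$$ With $\mu=\frac1N\sum_i\delta_{\mathbf{X}_i}$ and $\nu=\frac1N\sum_i\delta_{\mathbf{Y}_i}$, it is the threshold such that the minimizer over couplings $\gamma$ of $(\mu,\nu)$ of $\int c\,d\gamma+\frac1\eta\left\|\frac{d\gamma}{d(\mu\otimes\nu)}\right\|^2_{L^2(\mu\otimes\nu)}$ is also a minimizer of $\int c\,d\gamma$ if and only if $\eta\ge\eta^*$. *)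

theory Defs
  imports "HOL-Analysis.Analysis"
begin

text \<open>
  Matrices in \<open>\<real>\<^bsup>N \<times> N\<^esup>\<close> are elements of \<open>real^'n^'n\<close> with \<open>N = CARD('n)\<close>.
  On this type \<open>\<bullet>\<close> and \<open>norm\<close> are the Frobenius inner product and norm, and
  \<open>1 :: real^'n\<close> is the all-ones vector.
\<close>

definition birkhoff_polytope :: "(real^'n^'n) set" where
  "birkhoff_polytope = {\<pi>. \<pi> *v 1 = 1 \<and> transpose \<pi> *v 1 = 1 \<and> (\<forall>i j. 0 \<le> \<pi> $ i $ j)}"

definition cost_matrix :: "('a \<Rightarrow> 'b \<Rightarrow> real) \<Rightarrow> ('n \<Rightarrow> 'a) \<Rightarrow> ('n \<Rightarrow> 'b) \<Rightarrow> real^'n^'n" where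
  "cost_matrix c X Y = (\<chi> i j. c (X i) (Y j))"

definition optimal_set :: "real^'n^'n \<Rightarrow> (real^'n^'n) set" where
  "optimal_set C = {\<pi>. is_arg_min (\<lambda>\<pi>. C \<bullet> \<pi>) (\<lambda>\<pi>. \<pi> \<in> birkhoff_polytope) \<pi>}"

text \<open>
  The minimizer exists and is unique, since \<open>optimal_set C\<close> is nonempty, compact and convex
  and the squared norm is strictly convex;
  hence the choice made by \<open>arg_min_on\<close> is immaterial.
\<close>

definition min_norm_optimal :: "real^'n^'n \<Rightarrow> real^'n^'n" where
  "min_norm_optimal C = arg_min_on (\<lambda>\<pi>. (norm \<pi>)\<^sup>2) (optimal_set C)"

text \<open>
  The maximum is over a finite set, as a polytope has finitely many extreme points. It is only
  meaningful if some extreme point is not optimal; otherwise its value is unspecified.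
\<close>

definition critical_value :: "real^'n^'n \<Rightarrow> real" where
  "critical_value C =
     2 * real CARD('n) *
       Max {(min_norm_optimal C \<bullet> (min_norm_optimal C - \<pi>)) / (C \<bullet> (\<pi> - min_norm_optimal C)) | \<pi>.
              \<pi> \<in> {\<pi>. \<pi> extreme_point_of birkhoff_polytope} - optimal_set C}"

end

theory Submission
  imports Defs
begin

text \<open>
  Every competitor \<open>\<pi>\<close> moves the mass \<open>s = \<langle>P, P - \<pi>\<rangle>\<close> off the matched entries, where \<open>P\<close> is the
  permutation matrix of \<open>\<sigma>\<close>. Each unit of moved mass costs at least \<open>\<kappa> - \<epsilon>\<^sub>M\<close>, so
  \<open>P\<close> is the unique optimal plan and every ratio in the critical value is at most
  \<open>1 / (\<kappa> - \<epsilon>\<^sub>M)\<close>. For the lower bounds, swapping two targets of \<open>\<sigma>\<close> gives a vertex with \<open>s = 2\<close>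
  and excess cost at most \<open>\<kappa>' - 2 \<epsilon>\<^sub>m\<close> for the best choice of the swapped pair.
\<close>

section \<open>Permutation matrices as vertices of the Birkhoff polytope\<close>

definition permutation_matrix :: "('n \<Rightarrow> 'n) \<Rightarrow> real^'n^'n::finite" where
  "permutation_matrix \<rho> = (\<chi> i j. of_bool (j = \<rho> i))"

lemma permutation_matrix_nth [simp]: "permutation_matrix \<rho> $ i $ j = of_bool (j = \<rho> i)"
  by (simp add: permutation_matrix_def)

lemma birkhoff_polytope_iff:
  "\<pi> \<in> birkhoff_polytope \<longleftrightarrow>
     (\<forall>i. (\<Sum>j\<in>UNIV. \<pi> $ i $ j) = 1) \<and> (\<forall>j. (\<Sum>i\<in>UNIV. \<pi> $ i $ j) = 1) \<and> (\<forall>i j. 0 \<le> \<pi> $ i $ j)"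
  by (auto simp: birkhoff_polytope_def vec_eq_iff matrix_vector_mult_def transpose_def)

lemma birkhoff_polytope_le_1:
  assumes "\<pi> \<in> birkhoff_polytope"
  shows "\<pi> $ i $ j \<le> 1"
  using assms member_le_sum[of j UNIV "\<lambda>j. \<pi> $ i $ j"] by (simp add: birkhoff_polytope_iff)

lemma permutation_matrix_in_birkhoff:
  assumes "\<rho> permutes UNIV"
  shows "permutation_matrix \<rho> \<in> birkhoff_polytope"
proof -
  have "(\<Sum>i\<in>UNIV. of_bool (j = \<rho> i)) = (1::real)" for j
    using sum.permute[OF assms, of "\<lambda>k. of_bool (j = k) :: real"] by (simp add: of_bool_def)
  then show ?thesis
    by (simp add: birkhoff_polytope_iff of_bool_def)
qed

text \<open>Entries of \<open>a\<close> and \<open>b\<close> lie in [0,1], and a strict convex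
  combination reaches an endpoint of that interval only if both points sit there. At entries equal
  to 1 the argument is run on the complements. This makes swapped matchings admissible in the
  maximum.\<close>

lemma permutation_matrix_extreme:
  assumes "\<rho> permutes UNIV"
  shows "permutation_matrix \<rho> extreme_point_of birkhoff_polytope"
  unfolding extreme_point_of_def
proof (intro conjI ballI notI)
  show "permutation_matrix \<rho> \<in> birkhoff_polytope"
    by (rule permutation_matrix_in_birkhoff[OF assms])
next
  fix a b :: "real^'a^'a"
  assume ab: "a \<in> birkhoff_polytope" "b \<in> birkhoff_polytope"
    and "permutation_matrix \<rho> \<in> open_segment a b"
  then obtain u where u: "0 < u" "u < 1" and "a \<noteq> b"
    and eq: "permutation_matrix \<rho> = (1 - u) *\<^sub>R a + u *\<^sub>R b"
    by (auto simp: in_segment)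
  have "a $ i $ j = b $ i $ j" for i j
  proof -
    have e: "of_bool (j = \<rho> i) = (1 - u) * a $ i $ j + u * b $ i $ j"
      using arg_cong[OF eq, of "\<lambda>m. m $ i $ j"] by simp
    have bds: "0 \<le> a $ i $ j" "a $ i $ j \<le> 1" "0 \<le> b $ i $ j" "b $ i $ j \<le> 1"
      using ab birkhoff_polytope_le_1 by (auto simp: birkhoff_polytope_iff)
    show ?thesis
    proof (cases "j = \<rho> i")
      case True
      then have "(1 - u) * (1 - a $ i $ j) + u * (1 - b $ i $ j) = 0"
        using e by (simp add: algebra_simps)
      then show ?thesis
        using u bds by (simp add: add_nonneg_eq_0_iff)
    next
      case False
      then show ?thesis
        using e u bds by (simp add: add_nonneg_eq_0_iff)
    qed
  qed
  with \<open>a \<noteq> b\<close> show False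
    by (simp add: vec_eq_iff)
qed

text \<open>Row and column sums cut out hyperplanes and nonnegativity cuts out halfspaces. This
  yields finitely many extreme points, so that \<open>Max\<close> in the critical value ranges over
  a finite set.\<close>

lemma polyhedron_birkhoff: "polyhedron (birkhoff_polytope :: (real^'n^'n::finite) set)"
proof -
  let ?row = "\<lambda>i. {\<pi> :: real^'n^'n. (\<chi> k l. of_bool (k = i)) \<bullet> \<pi> = 1}"
  let ?col = "\<lambda>j. {\<pi> :: real^'n^'n. (\<chi> k l. of_bool (l = j)) \<bullet> \<pi> = 1}"
  let ?pos = "\<lambda>(i, j). {\<pi> :: real^'n^'n. axis i (axis j 1) \<bullet> \<pi> \<ge> 0}"
  have "birkhoff_polytope = \<Inter> (range ?row \<union> range ?col \<union> range ?pos)"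
    by (auto simp: birkhoff_polytope_iff ball_Un inner_vec_def of_bool_def axis_def if_distrib if_distribR
        sum.swap[of _ UNIV UNIV] cong: if_cong)
  moreover have "polyhedron \<dots>"
    by (rule polyhedron_Inter) (auto simp: polyhedron_hyperplane polyhedron_halfspace_ge)
  ultimately show ?thesis
    by simp
qed

section \<open>Moved mass and excess cost\<close>

lemma inner_permutation_matrix: "A \<bullet> permutation_matrix \<rho> = (\<Sum>i\<in>UNIV. A $ i $ \<rho> i)"
  by (simp add: inner_vec_def of_bool_def if_distrib cong: if_cong)

text \<open>Only rows \<open>i\<close> and \<open>j\<close> change under the swap. The matrix
  \<open>A\<close> is left general because it is taken both as the cost matrix, for the excess cost,
  and as \<open>permutation_matrix \<sigma>\<close>, for the moved mass.\<close>

lemma inner_swap_diff: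
  fixes A :: "real^'n^'n::finite"
  assumes "i \<noteq> j"
  shows "A \<bullet> (permutation_matrix (\<rho> \<circ> Transposition.transpose i j) - permutation_matrix \<rho>) =
    A $ i $ \<rho> j + A $ j $ \<rho> i - A $ i $ \<rho> i - A $ j $ \<rho> j"
proof -
  let ?t = "\<rho> \<circ> Transposition.transpose i j"
  have "A \<bullet> (permutation_matrix ?t - permutation_matrix \<rho>) =
      (\<Sum>k\<in>UNIV. A $ k $ ?t k - A $ k $ \<rho> k)"
    by (simp add: inner_diff_right inner_permutation_matrix sum_subtractf)
  also have "\<dots> = (\<Sum>k\<in>{i, j}. A $ k $ ?t k - A $ k $ \<rho> k)"
    by (rule sum.mono_neutral_right) (auto simp: transpose_def)
  finally show ?thesis
    using assms by simp
qed

lemma inner_moved_mass: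
  "permutation_matrix \<rho> \<bullet> (permutation_matrix \<rho> - \<pi>) = (\<Sum>i\<in>UNIV. 1 - \<pi> $ i $ \<rho> i)"
  by (subst inner_commute) (simp add: inner_permutation_matrix)

lemma moved_mass_nonneg:
  assumes "\<pi> \<in> birkhoff_polytope"
  shows "0 \<le> permutation_matrix \<rho> \<bullet> (permutation_matrix \<rho> - \<pi>)"
  using birkhoff_polytope_le_1[OF assms] by (simp add: inner_moved_mass sum_nonneg)

text \<open>The moved mass is a sum of nonnegative deficits. If it vanishes, every matched entry
  equals 1 and exhausts its row sum, which forces all other entries to 0.\<close>

lemma moved_mass_pos:
  assumes \<pi>: "\<pi> \<in> birkhoff_polytope" and ne: "\<pi> \<noteq> permutation_matrix \<rho>"
  shows "0 < permutation_matrix \<rho> \<bullet> (permutation_matrix \<rho> - \<pi>)"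
proof (rule ccontr)
  assume "\<not> ?thesis"
  then have "(\<Sum>i\<in>UNIV. 1 - \<pi> $ i $ \<rho> i) = 0"
    using moved_mass_nonneg[OF \<pi>, of \<rho>] by (simp add: inner_moved_mass)
  then have diag: "\<pi> $ i $ \<rho> i = 1" for i
    using birkhoff_polytope_le_1[OF \<pi>] by (simp add: sum_nonneg_eq_0_iff)
  have "\<pi> $ i $ j = 0" if "j \<noteq> \<rho> i" for i j
  proof -
    have "(\<Sum>j\<in>{\<rho> i, j}. \<pi> $ i $ j) \<le> (\<Sum>j\<in>UNIV. \<pi> $ i $ j)"
      using \<pi> by (intro sum_mono2) (auto simp: birkhoff_polytope_iff)
    then have "\<pi> $ i $ j \<le> 0"
      using \<pi> that diag by (simp add: birkhoff_polytope_iff)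
    then show ?thesis
      using \<pi> by (simp add: birkhoff_polytope_iff order_antisym)
  qed
  with diag have "\<pi> = permutation_matrix \<rho>"
    by (simp add: vec_eq_iff)
  with ne show False ..
qed

text \<open>Argue row by row. Both rows sum to 1, so lowering all costs by the constant
  \<open>k\<close> does not change the excess. After this shift unmatched entries contribute
  nonnegatively, and the matched entry contributes at least \<open>k - M\<close> per unit of lost
  mass.\<close>

lemma excess_cost_ge:
  fixes C \<pi> :: "real^'n^'n::finite"
  assumes \<pi>: "\<pi> \<in> birkhoff_polytope"
    and matched: "\<And>i. C $ i $ \<rho> i \<le> M" and unmatched: "\<And>i j. j \<noteq> \<rho> i \<Longrightarrow> k \<le> C $ i $ j"
  shows "(k - M) * (permutation_matrix \<rho> \<bullet> (permutation_matrix \<rho> - \<pi>))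
    \<le> C \<bullet> (\<pi> - permutation_matrix \<rho>)"
proof -
  let ?P = "permutation_matrix \<rho>"
  have "(k - M) * (1 - \<pi> $ i $ \<rho> i) \<le> (\<Sum>j\<in>UNIV. C $ i $ j * (\<pi> $ i $ j - ?P $ i $ j))" for i
  proof -
    \<comment> \<open>The bound is placed entirely in column \<open>\<rho> i\<close>, so that the
      two sums can be compared term by term.\<close>
    have "(k - M) * (1 - \<pi> $ i $ \<rho> i) =
        (\<Sum>j\<in>UNIV. if j = \<rho> i then (k - M) * (1 - \<pi> $ i $ \<rho> i) else 0)"
      by simp
    also have "\<dots> \<le> (\<Sum>j\<in>UNIV. (C $ i $ j - k) * (\<pi> $ i $ j - ?P $ i $ j))"
    proof (rule sum_mono)
      fix j
      have "(k - M) * (1 - \<pi> $ i $ \<rho> i) \<le> (k - C $ i $ \<rho> i) * (1 - \<pi> $ i $ \<rho> i)"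
        using matched[of i] birkhoff_polytope_le_1[OF \<pi>] by (intro mult_right_mono) auto
      moreover have "0 \<le> (C $ i $ j - k) * \<pi> $ i $ j" if "j \<noteq> \<rho> i"
        using unmatched[OF that] \<pi> by (simp add: birkhoff_polytope_iff)
      ultimately show "(if j = \<rho> i then (k - M) * (1 - \<pi> $ i $ \<rho> i) else 0)
          \<le> (C $ i $ j - k) * (\<pi> $ i $ j - ?P $ i $ j)"
        by (simp add: algebra_simps)
    qed
    also have "\<dots> = (\<Sum>j\<in>UNIV. C $ i $ j * (\<pi> $ i $ j - ?P $ i $ j)) -
        k * ((\<Sum>j\<in>UNIV. \<pi> $ i $ j) - (\<Sum>j\<in>UNIV. ?P $ i $ j))"
      by (simp only: left_diff_distrib sum_subtractf flip: sum_distrib_left)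
    also have "\<dots> = (\<Sum>j\<in>UNIV. C $ i $ j * (\<pi> $ i $ j - ?P $ i $ j))"
      using \<pi> by (simp add: birkhoff_polytope_iff of_bool_def)
    finally show ?thesis .
  qed
  then have "(\<Sum>i\<in>UNIV. (k - M) * (1 - \<pi> $ i $ \<rho> i))
      \<le> (\<Sum>i\<in>UNIV. \<Sum>j\<in>UNIV. C $ i $ j * (\<pi> $ i $ j - ?P $ i $ j))"
    by (rule sum_mono)
  then show ?thesis
    by (simp add: inner_moved_mass inner_vec_def sum_distrib_left)
qed

section \<open>Unique optimality and the bounds on the critical value\<close>

lemma optimal_set_unique:
  assumes "P \<in> birkhoff_polytope"
    and "\<And>\<pi>. \<pi> \<in> birkhoff_polytope \<Longrightarrow> \<pi> \<noteq> P \<Longrightarrow> 0 < C \<bullet> (\<pi> - P)"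
  shows "optimal_set C = {P}"
proof -
  have less: "C \<bullet> P < C \<bullet> \<pi>" if "\<pi> \<in> birkhoff_polytope" "\<pi> \<noteq> P" for \<pi>
    using assms(2)[OF that] by (simp add: inner_diff_right)
  show ?thesis
    unfolding optimal_set_def is_arg_min_def using assms(1) less by (auto dest: less_asym)
qed

lemma min_norm_optimal_singleton:
  assumes "optimal_set C = {P}"
  shows "min_norm_optimal C = P"
  unfolding min_norm_optimal_def assms
  using arg_min_if_finite(1)[of "{P}"] by simp

theorem corollary3p2:
  fixes X Y :: "'n::finite \<Rightarrow> real^'d"
    and c :: "real^'d \<Rightarrow> real^'d \<Rightarrow> real"
    and \<sigma> :: "'n \<Rightarrow> 'n"
    and \<epsilon>\<^sub>m \<epsilon>\<^sub>M \<kappa> \<kappa>' \<eta> N :: real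
  assumes N_def: "N = real CARD('n)"
    and N_ge_2: "CARD('n) \<ge> 2"
    and eps: "0 \<le> \<epsilon>\<^sub>m" "\<epsilon>\<^sub>m \<le> \<epsilon>\<^sub>M"
    and perm: "\<sigma> permutes UNIV"
    and kappa_def: "\<kappa> = Min {c (X i) (Y j) | i j. j \<noteq> \<sigma> i}"
    and kappa_gt: "\<kappa> > \<epsilon>\<^sub>M"
    and matched: "\<forall>i. c (X i) (Y (\<sigma> i)) \<in> {\<epsilon>\<^sub>m..\<epsilon>\<^sub>M}"
    and kappa'_def: "\<kappa>' = Min {c (X i) (Y (\<sigma> j)) + c (X j) (Y (\<sigma> i)) | i j. i \<noteq> j}"
    and eta_def: "\<eta> = critical_value (cost_matrix c X Y)"
  shows "4 * N / (\<kappa>' - 2 * \<epsilon>\<^sub>m) \<le> \<eta> \<and> \<eta> \<le> 2 * N / (\<kappa> - \<epsilon>\<^sub>M) \<and>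
    ((\<forall>i j. c (X i) (Y (\<sigma> j)) = c (X j) (Y (\<sigma> i))) \<longrightarrow>
       2 * N / (\<kappa> - \<epsilon>\<^sub>m) \<le> \<eta> \<and> \<eta> \<le> 2 * N / (\<kappa> - \<epsilon>\<^sub>M) \<and>
       (\<epsilon>\<^sub>m = 0 \<and> \<epsilon>\<^sub>M = 0 \<longrightarrow> \<eta> = 2 * N / \<kappa>))"
proof -
  let ?C = "cost_matrix c X Y" and ?P = "permutation_matrix \<sigma>"
  let ?ratio = "\<lambda>\<pi>. (?P \<bullet> (?P - \<pi>)) / (?C \<bullet> (\<pi> - ?P))"
  let ?V = "{\<pi>. \<pi> extreme_point_of birkhoff_polytope} - {?P}"
  let ?S = "{c (X i) (Y j) | i j. j \<noteq> \<sigma> i}"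
  let ?S' = "{c (X i) (Y (\<sigma> j)) + c (X j) (Y (\<sigma> i)) | i j. i \<noteq> j}"
  have inj: "\<sigma> i = \<sigma> j \<longleftrightarrow> i = j" for i j
    using permutes_inj[OF perm] by (auto dest: injD)
  \<comment> \<open>Two distinct indices make both index sets nonempty, so that the minima
    \<open>\<kappa>\<close> and \<open>\<kappa>'\<close> are attained.\<close>
  obtain i0 j0 :: 'n where i0j0: "i0 \<noteq> j0"
    using N_ge_2 card_le_Suc0_iff_eq[of "UNIV :: 'n set"] by fastforce
  have fin: "finite ?S" "finite ?S'"
    by (rule finite_subset[of _ "(\<lambda>(i, j). c (X i) (Y j)) ` UNIV"]
          finite_subset[of _ "(\<lambda>(i, j). c (X i) (Y (\<sigma> j)) + c (X j) (Y (\<sigma> i))) ` UNIV"]; force)+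
  have ne: "?S \<noteq> {}" "?S' \<noteq> {}"
    using i0j0 inj by blast+
  have kappa_le: "\<kappa> \<le> c (X i) (Y j)" if "j \<noteq> \<sigma> i" for i j
    unfolding kappa_def using fin(1) that by (auto intro: Min_le)
  have kappa'_le: "\<kappa>' \<le> c (X i) (Y (\<sigma> j)) + c (X j) (Y (\<sigma> i))" if "i \<noteq> j" for i j
    unfolding kappa'_def using fin(2) that by (auto intro!: Min_le)
  obtain i1 j1 where ij1: "i1 \<noteq> j1" "\<kappa>' = c (X i1) (Y (\<sigma> j1)) + c (X j1) (Y (\<sigma> i1))"
    using Min_in[OF fin(2) ne(2)] kappa'_def by auto
  obtain i2 j2 where ij2: "j2 \<noteq> \<sigma> i2" "\<kappa> = c (X i2) (Y j2)"
    using Min_in[OF fin(1) ne(1)] kappa_def by auto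
  have excess: "(\<kappa> - \<epsilon>\<^sub>M) * (?P \<bullet> (?P - \<pi>)) \<le> ?C \<bullet> (\<pi> - ?P)" if "\<pi> \<in> birkhoff_polytope" for \<pi>
    using that matched kappa_le by (intro excess_cost_ge) (auto simp: cost_matrix_def)
  have excess_pos: "0 < ?C \<bullet> (\<pi> - ?P)" if "\<pi> \<in> birkhoff_polytope" "\<pi> \<noteq> ?P" for \<pi>
    using excess[OF that(1)] moved_mass_pos[OF that] kappa_gt
    by (metis diff_gt_0_iff_gt less_le_trans mult_pos_pos)
  have opt: "optimal_set ?C = {?P}"
    by (intro optimal_set_unique permutation_matrix_in_birkhoff[OF perm] excess_pos)
  \<comment> \<open>Since \<open>?P\<close> is the only optimal plan, it is both the minimal-norm
    one and the only vertex excluded from the maximum.\<close>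
  then have eta: "\<eta> = 2 * N * Max (?ratio ` ?V)"
    unfolding eta_def critical_value_def N_def
    by (simp only: min_norm_optimal_singleton[OF opt] opt Setcompr_eq_image Collect_mem_eq)
  have fin_ratio: "finite (?ratio ` ?V)"
    using finite_polyhedron_extreme_points[OF polyhedron_birkhoff] by blast
  \<comment> \<open>The swapped pair is one that attains \<open>\<kappa>'\<close>.\<close>
  define Q where "Q = permutation_matrix (\<sigma> \<circ> Transposition.transpose i1 j1)"
  have P_Q: "?P \<bullet> (?P - Q) = 2"
  proof -
    \<comment> \<open>By injectivity of \<open>\<sigma>\<close> the two crossed entries of
      \<open>?P\<close> are 0, while the two matched entries are 1.\<close>
    have "?P \<bullet> (Q - ?P) = -2"
      unfolding Q_def using ij1(1) by (simp add: inner_swap_diff inj)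
    then show ?thesis
      by (simp add: inner_diff_right)
  qed
  then have "Q \<noteq> ?P"
    by auto
  moreover have "Q extreme_point_of birkhoff_polytope"
    unfolding Q_def
    by (intro permutation_matrix_extreme permutes_compose[OF _ perm] permutes_swap_id) auto
  ultimately have Q: "Q \<in> ?V"
    by simp
  then have "0 < ?C \<bullet> (Q - ?P)"
    using excess_pos by (simp add: extreme_point_of_def)
  \<comment> \<open>The excess of \<open>Q\<close> is \<open>\<kappa>'\<close> minus two matched
    costs, each at least \<open>\<epsilon>\<^sub>m\<close>. As this excess is positive, so is the
    bound, and the reciprocals can be compared.\<close>
  moreover have "?C \<bullet> (Q - ?P) \<le> \<kappa>' - 2 * \<epsilon>\<^sub>m"
    unfolding Q_def inner_swap_diff[OF ij1(1)] using matched ij1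
    by (simp add: cost_matrix_def) (smt (verit))
  ultimately have "2 / (\<kappa>' - 2 * \<epsilon>\<^sub>m) \<le> ?ratio Q"
    unfolding P_Q by (intro divide_left_mono) auto
  also have "\<dots> \<le> Max (?ratio ` ?V)"
    using fin_ratio Q by (intro Max_ge) auto
  finally have lower: "4 * N / (\<kappa>' - 2 * \<epsilon>\<^sub>m) \<le> \<eta>"
    using mult_left_mono[of "2 / (\<kappa>' - 2 * \<epsilon>\<^sub>m)" _ "2 * N"] by (simp add: eta N_def)
  have "?ratio \<pi> \<le> 1 / (\<kappa> - \<epsilon>\<^sub>M)" if "\<pi> \<in> ?V" for \<pi>
    using that excess[of \<pi>] excess_pos[of \<pi>] kappa_gt
    by (simp add: extreme_point_of_def field_simps)
  then have "Max (?ratio ` ?V) \<le> 1 / (\<kappa> - \<epsilon>\<^sub>M)"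
    using fin_ratio Q by (subst Max_le_iff) auto
  from mult_left_mono[OF this, of "2 * N"] have upper: "\<eta> \<le> 2 * N / (\<kappa> - \<epsilon>\<^sub>M)"
    by (simp add: eta N_def)
  have lower_sym: "2 * N / (\<kappa> - \<epsilon>\<^sub>m) \<le> \<eta>"
    if sym: "\<forall>i j. c (X i) (Y (\<sigma> j)) = c (X j) (Y (\<sigma> i))"
  proof -
    \<comment> \<open>Symmetry gives \<open>\<kappa>' = 2 * \<kappa>\<close>: the entry attaining
      \<open>\<kappa>\<close> equals its mirror image, so that pair sums to
      \<open>2 * \<kappa>\<close>; conversely both summands of \<open>\<kappa>'\<close> are
      unmatched costs. The general lower bound then becomes the symmetric one.\<close>
    obtain k where k: "j2 = \<sigma> k"
      using permutes_surj[OF perm] by (meson surjD)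
    then have "\<kappa>' \<le> 2 * \<kappa>"
      using kappa'_le[of i2 k] ij2 sym by auto
    moreover have "2 * \<kappa> \<le> \<kappa>'"
      using ij1 kappa_le[of "\<sigma> j1" i1] kappa_le[of "\<sigma> i1" j1] inj by auto
    ultimately have "\<kappa>' = 2 * \<kappa>"
      by simp
    then have "4 * N / (\<kappa>' - 2 * \<epsilon>\<^sub>m) = 2 * N / (\<kappa> - \<epsilon>\<^sub>m)"
      using kappa_gt eps by (simp add: field_simps)
    with lower show ?thesis
      by simp
  qed
  \<comment> \<open>For \<open>\<epsilon>\<^sub>m = \<epsilon>\<^sub>M = 0\<close> the symmetric
    lower bound and the upper bound coincide.\<close>
  from lower upper lower_sym show ?thesis
    by auto
qed

end
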